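(* Let $S=\mathcal{ODP}_n$ and let $\alpha,\beta\in S$. Then $\alpha\le_{\mathcal D}\beta$ (in $S$) if and only if there exists an order-preserving isometry $\theta:\mathrm{Dom}\,\alpha\to\mathrm{Dom}\,\beta$, i.e. a (not necessarily surjective) map $\theta$ from $\mathrm{Dom}\,\alpha$ into $\mathrm{Dom}\,\beta$ such that for all $x,y\in\mathrm{Dom}\,\alpha$ one has $|x-y|=|x\theta-y\theta|$, and $x\le y$ implies $x\theta\le y\theta$.
   Context: For $n\ge 0$ let $X_n=\{1,2,\dots,n\}$ and let $\mathcal{I}_n$ be the symmetric inverse semigroup of all partial injective maps of $X_n$ (including the empty map). Maps are written on the right and composed left to right: $x(\alpha\beta)=(x\alpha)\beta$. $\mathcal{ODP}_n$ is the subsemigroup of all $\alpha\in\mathcal{I}_n$ such that for all $x,y\in\mathrm{Dom}\,\alpha$, $|x-y|=|x\alpha-y\alpha|$, and $x\le y$ implies $x\alpha\le y\alpha$ (order-preserving partial isometries); it contains the identity of $X_n$. For a monoid $S$ and $a,b\in S$: $a\le_{\mathcal R}b$ means $a=bs$ for some $s\in S$; $a\le_{\mathcal L}b$ means $a=sb$ for some $s\in S$; $a\le_{\mathcal D}b$ means there exists $d\in S$ with $a\le_{\mathcal R}d$ and $d\le_{\mathcal L}b$. *)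

theory Defs
  imports "HOL-Algebra.Group"
begin

(* Partial maps act on the right and are composed from left to right: the product of
   a and b applies a first, hence the reversed map_comp. *)
definition sym_inv_monoid :: "nat \<Rightarrow> (nat \<rightharpoonup> nat) monoid" where
  "sym_inv_monoid n =
     \<lparr>carrier = {a. dom a \<subseteq> {1..n} \<and> ran a \<subseteq> {1..n} \<and> inj_on a (dom a)},
      mult = (\<lambda>a b. b \<circ>\<^sub>m a),
      one = Some |` {1..n}\<rparr>"

(* Distances are taken in int because subtraction on nat truncates. *)
definition op_isometry_on :: "nat set \<Rightarrow> (nat \<Rightarrow> nat) \<Rightarrow> bool" where
  "op_isometry_on A f \<longleftrightarrow>
     (\<forall>x\<in>A. \<forall>y\<in>A. \<bar>int x - int y\<bar> = \<bar>int (f x) - int (f y)\<bar> \<and> (x \<le> y \<longrightarrow> f x \<le> f y))"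

definition ODP :: "nat \<Rightarrow> (nat \<rightharpoonup> nat) monoid" where
  "ODP n = (sym_inv_monoid n)
     \<lparr>carrier := {a \<in> carrier (sym_inv_monoid n). op_isometry_on (dom a) (\<lambda>x. the (a x))}\<rparr>"

definition le_R :: "('a, 'b) monoid_scheme \<Rightarrow> 'a \<Rightarrow> 'a \<Rightarrow> bool" where
  "le_R S a b \<longleftrightarrow> (\<exists>s\<in>carrier S. a = b \<otimes>\<^bsub>S\<^esub> s)"

definition le_L :: "('a, 'b) monoid_scheme \<Rightarrow> 'a \<Rightarrow> 'a \<Rightarrow> bool" where
  "le_L S a b \<longleftrightarrow> (\<exists>s\<in>carrier S. a = s \<otimes>\<^bsub>S\<^esub> b)"

definition le_D :: "('a, 'b) monoid_scheme \<Rightarrow> 'a \<Rightarrow> 'a \<Rightarrow> bool" where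
  "le_D S a b \<longleftrightarrow> (\<exists>d\<in>carrier S. le_R S a d \<and> le_L S d b)"

lemma map_comp_assoc': "(c \<circ>\<^sub>m b) \<circ>\<^sub>m a = c \<circ>\<^sub>m (b \<circ>\<^sub>m a)"
  by (rule ext) (simp add: map_comp_def split: option.splits)

lemma sym_inv_comp_closed:
  assumes "a \<in> carrier (sym_inv_monoid n)" "b \<in> carrier (sym_inv_monoid n)"
  shows "b \<circ>\<^sub>m a \<in> carrier (sym_inv_monoid n)"
proof -
  have inj: "x = y" if "a x = Some z" "a y = Some z" for x y z
    using assms(1) that by (auto simp: sym_inv_monoid_def inj_on_def dom_def)
  have inj': "x = y" if "b x = Some z" "b y = Some z" for x y z
    using assms(2) that by (auto simp: sym_inv_monoid_def inj_on_def dom_def)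
  have "dom (b \<circ>\<^sub>m a) \<subseteq> dom a" "ran (b \<circ>\<^sub>m a) \<subseteq> ran b"
    by (auto simp: map_comp_def ran_def split: option.splits)
  moreover have "inj_on (b \<circ>\<^sub>m a) (dom (b \<circ>\<^sub>m a))"
  proof (rule inj_onI)
    fix x y assume "x \<in> dom (b \<circ>\<^sub>m a)" and eq: "(b \<circ>\<^sub>m a) x = (b \<circ>\<^sub>m a) y"
    then obtain z where z: "(b \<circ>\<^sub>m a) x = Some z" "(b \<circ>\<^sub>m a) y = Some z"
      by (metis domD)
    then obtain u v where uv: "a x = Some u" "b u = Some z" "a y = Some v" "b v = Some z"
      by (auto simp: map_comp_Some_iff)
    then have "u = v"
      by (blast intro: inj')
    with uv show "x = y"
      by (blast intro: inj)
  qed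
  ultimately show ?thesis
    using assms by (auto simp: sym_inv_monoid_def)
qed

lemma sym_inv_one: "Some |` {1..n} \<in> carrier (sym_inv_monoid n)"
  by (auto simp: sym_inv_monoid_def ran_def restrict_map_def inj_on_def split: if_splits)

lemma sym_inv_comp_one:
  assumes "a \<in> carrier (sym_inv_monoid n)"
  shows "a \<circ>\<^sub>m (Some |` {1..n}) = a" and "(Some |` {1..n}) \<circ>\<^sub>m a = a"
proof -
  have d: "a x = None" if "x \<notin> {1..n}" for x
    using assms that unfolding sym_inv_monoid_def by (auto simp: dom_def)
  have r: "y \<in> {1..n}" if "a x = Some y" for x y
    using assms that ranI[of a x y] unfolding sym_inv_monoid_def by auto
  show "a \<circ>\<^sub>m (Some |` {1..n}) = a"
    by (rule ext) (auto simp: map_comp_def restrict_map_def d)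
  show "(Some |` {1..n}) \<circ>\<^sub>m a = a"
    by (rule ext) (use r in \<open>force simp: map_comp_def restrict_map_def split: option.splits\<close>)
qed

lemma monoid_sym_inv_monoid: "monoid (sym_inv_monoid n)"
proof (rule monoidI)
qed (use sym_inv_comp_closed sym_inv_one sym_inv_comp_one in
     \<open>auto simp: map_comp_assoc' sym_inv_monoid_def\<close>)

lemma submonoid_ODP: "submonoid (carrier (ODP n)) (sym_inv_monoid n)"
proof
  show "carrier (ODP n) \<subseteq> carrier (sym_inv_monoid n)"
    by (auto simp: ODP_def)
  show "\<one>\<^bsub>sym_inv_monoid n\<^esub> \<in> carrier (ODP n)"
    using sym_inv_one[of n]
    by (auto simp: ODP_def op_isometry_on_def) (auto simp: sym_inv_monoid_def restrict_map_def split: if_splits)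
next
  fix a b assume a: "a \<in> carrier (ODP n)" and b: "b \<in> carrier (ODP n)"
  have "op_isometry_on (dom (b \<circ>\<^sub>m a)) (\<lambda>x. the ((b \<circ>\<^sub>m a) x))"
    unfolding op_isometry_on_def
  proof (intro ballI)
    fix x y assume "x \<in> dom (b \<circ>\<^sub>m a)" "y \<in> dom (b \<circ>\<^sub>m a)"
    then obtain u v u' v' where *: "a x = Some u" "b u = Some u'" "a y = Some v" "b v = Some v'"
      by (auto simp: map_comp_Some_iff)
    have "\<bar>int x - int y\<bar> = \<bar>int u - int v\<bar> \<and> (x \<le> y \<longrightarrow> u \<le> v)"
      using a * unfolding ODP_def op_isometry_on_def by (force simp: dom_def)
    moreover have "\<bar>int u - int v\<bar> = \<bar>int u' - int v'\<bar> \<and> (u \<le> v \<longrightarrow> u' \<le> v')"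
      using b * unfolding ODP_def op_isometry_on_def by (force simp: dom_def)
    ultimately show "\<bar>int x - int y\<bar> = \<bar>int (the ((b \<circ>\<^sub>m a) x)) - int (the ((b \<circ>\<^sub>m a) y))\<bar> \<and>
        (x \<le> y \<longrightarrow> the ((b \<circ>\<^sub>m a) x) \<le> the ((b \<circ>\<^sub>m a) y))"
      using * by auto
  qed
  then show "a \<otimes>\<^bsub>sym_inv_monoid n\<^esub> b \<in> carrier (ODP n)"
    using a b sym_inv_comp_closed[of a n b] by (auto simp: ODP_def) (auto simp: sym_inv_monoid_def)
qed

lemma monoid_ODP: "monoid (ODP n)"
  using submonoid.submonoid_is_monoid[OF submonoid_ODP monoid_sym_inv_monoid, of n]
  by (simp add: ODP_def)

end

theory Submission
  imports Defs
begin

text \<open>The relation \<open>\<alpha> \<le>\<^sub>\<D> \<beta>\<close> says \<open>\<alpha> = \<tau>\<beta>\<sigma>\<close>, and then \<open>\<tau>\<close> restricted to \<open>Dom \<alpha>\<close> is the required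
  isometry. Conversely, an isometry \<open>\<theta>\<close> of \<open>Dom \<alpha>\<close> into \<open>Dom \<beta>\<close> is itself an element of the monoid,
  \<open>\<theta>\<beta>\<close> has the same domain as \<open>\<alpha>\<close>, and any two elements with the same domain are
  \<open>\<R>\<close>-related because inverses of order-preserving isometries are order-preserving isometries.\<close>

text \<open>Monotonicity fixes the sign of each difference, so equal distances become equal signed
  differences: these maps are restrictions of translations.\<close>

lemma op_isometry_on_iff:
  "op_isometry_on A f \<longleftrightarrow> (\<forall>x\<in>A. \<forall>y\<in>A. int (f x) - int (f y) = int x - int y)"
proof
  assume *: "op_isometry_on A f"
  have "int (f x) - int (f y) = int x - int y" if "x \<in> A" "y \<in> A" for x y
  proof -
    have "\<bar>int x - int y\<bar> = \<bar>int (f x) - int (f y)\<bar>" "x \<le> y \<longrightarrow> f x \<le> f y" "y \<le> x \<longrightarrow> f y \<le> f x"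
      using * that by (auto simp: op_isometry_on_def)
    then show ?thesis by linarith
  qed
  then show "\<forall>x\<in>A. \<forall>y\<in>A. int (f x) - int (f y) = int x - int y" by blast
next
  assume *: "\<forall>x\<in>A. \<forall>y\<in>A. int (f x) - int (f y) = int x - int y"
  have "\<bar>int x - int y\<bar> = \<bar>int (f x) - int (f y)\<bar> \<and> (x \<le> y \<longrightarrow> f x \<le> f y)"
    if "x \<in> A" "y \<in> A" for x y
    using *[rule_format, OF that] by linarith
  then show "op_isometry_on A f"
    by (auto simp: op_isometry_on_def)
qed

text \<open>Injectivity is absorbed by the difference condition, since equal images force difference
  zero between the arguments.\<close>

lemma carrier_ODP_iff:
  "a \<in> carrier (ODP n) \<longleftrightarrow> dom a \<subseteq> {1..n} \<and> ran a \<subseteq> {1..n} \<and>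
     (\<forall>x y u v. a x = Some u \<longrightarrow> a y = Some v \<longrightarrow> int u - int v = int x - int y)"
proof -
  have "inj_on a (dom a)"
    if "\<forall>x y u v. a x = Some u \<longrightarrow> a y = Some v \<longrightarrow> int u - int v = int x - int y"
    using that by (fastforce simp: inj_on_def dom_def)
  moreover have "op_isometry_on (dom a) (\<lambda>x. the (a x)) \<longleftrightarrow>
     (\<forall>x y u v. a x = Some u \<longrightarrow> a y = Some v \<longrightarrow> int u - int v = int x - int y)"
    by (force simp: op_isometry_on_iff dom_def)
  ultimately show ?thesis
    by (auto simp: ODP_def sym_inv_monoid_def)
qed

lemma mult_ODP [simp]: "a \<otimes>\<^bsub>ODP n\<^esub> b = b \<circ>\<^sub>m a"
  by (simp add: ODP_def sym_inv_monoid_def)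

text \<open>A product \<open>b s\<close> is defined only where \<open>b\<close> is. Conversely,
  \<open>b\<close> followed by its inverse is the identity on \<open>dom b\<close>, so the inverse
  of \<open>b\<close> followed by \<open>a\<close> serves as right multiplier.\<close>

lemma le_R_ODP_iff:
  assumes a: "a \<in> carrier (ODP n)" and b: "b \<in> carrier (ODP n)"
  shows "le_R (ODP n) a b \<longleftrightarrow> dom a \<subseteq> dom b"
proof
  assume "le_R (ODP n) a b"
  then show "dom a \<subseteq> dom b"
    by (auto simp: le_R_def map_comp_Some_iff)
next
  assume dom: "dom a \<subseteq> dom b"
  have inj: "x = y" if "b x = Some u" "b y = Some u" for x y u
    using b that by (fastforce simp: carrier_ODP_iff)
  \<comment> \<open>This is the inverse of \<open>b\<close> followed by \<open>a\<close>; the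
    description is well defined on \<open>ran b\<close> by \<open>inj\<close>.\<close>
  define s where "s = (\<lambda>u. if u \<in> ran b then a (THE x. b x = Some u) else None)"
  have s: "s u = a x" if "b x = Some u" for x u
  proof -
    have "(THE x. b x = Some u) = x"
      using that inj by blast
    with that show ?thesis
      by (auto simp: s_def ran_def)
  qed
  \<comment> \<open>Each pair in the graph of \<open>s\<close> comes from a common \<open>x\<close>,
    which reduces membership of \<open>s\<close> in the monoid to that of \<open>a\<close> and
    \<open>b\<close>.\<close>
  have s_SomeE: "\<exists>x. b x = Some u \<and> a x = Some w" if sw: "s u = Some w" for u w
  proof -
    obtain x where x: "b x = Some u"
      using sw by (auto simp: s_def ran_def split: if_splits)
    with s[OF x] sw show ?thesis by auto
  qed
  have "s \<in> carrier (ODP n)"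
    unfolding carrier_ODP_iff
  proof (intro conjI allI impI)
    show "dom s \<subseteq> {1..n}" "ran s \<subseteq> {1..n}"
      using a b s_SomeE unfolding carrier_ODP_iff by (fastforce simp: ran_def)+
    fix u v w z assume "s u = Some w" "s v = Some z"
    then obtain x y where "b x = Some u" "a x = Some w" "b y = Some v" "a y = Some z"
      using s_SomeE by metis
    with a b show "int w - int z = int u - int v"
      unfolding carrier_ODP_iff by metis
  qed
  moreover have "a = b \<otimes>\<^bsub>ODP n\<^esub> s"
  proof
    fix x show "a x = (b \<otimes>\<^bsub>ODP n\<^esub> s) x"
      \<comment> \<open>Where \<open>b\<close> is undefined, so is \<open>a\<close>, by the
        inclusion of domains; elsewhere \<open>s\<close> recovers the value of
        \<open>a\<close>.\<close>
      using dom s by (cases "b x") (auto simp: map_comp_def)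
  qed
  ultimately show "le_R (ODP n) a b"
    by (auto simp: le_R_def)
qed

theorem theorem2p3:
  fixes n :: nat and \<alpha> \<beta> :: "nat \<rightharpoonup> nat"
  assumes "\<alpha> \<in> carrier (ODP n)" and "\<beta> \<in> carrier (ODP n)"
  shows "le_D (ODP n) \<alpha> \<beta> \<longleftrightarrow>
    (\<exists>\<theta> :: nat \<Rightarrow> nat. \<theta> ` dom \<alpha> \<subseteq> dom \<beta> \<and> op_isometry_on (dom \<alpha>) \<theta>)"
proof
  assume "le_D (ODP n) \<alpha> \<beta>"
  then obtain \<tau> where \<tau>: "\<tau> \<in> carrier (ODP n)" and "\<beta> \<circ>\<^sub>m \<tau> \<in> carrier (ODP n)"
    and "le_R (ODP n) \<alpha> (\<beta> \<circ>\<^sub>m \<tau>)"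
    by (auto simp: le_D_def le_L_def)
  then have dom: "dom \<alpha> \<subseteq> dom (\<beta> \<circ>\<^sub>m \<tau>)"
    using assms(1) le_R_ODP_iff by blast
  \<comment> \<open>On the domain of the composite, \<tau> is defined and takes values in the domain
    of \<beta>.\<close>
  have "(\<lambda>x. the (\<tau> x)) ` dom \<alpha> \<subseteq> dom \<beta>"
    using dom by (fastforce simp: map_comp_Some_iff)
  moreover have "dom \<alpha> \<subseteq> dom \<tau>"
    using dom by (fastforce simp: map_comp_Some_iff)
  then have "op_isometry_on (dom \<alpha>) (\<lambda>x. the (\<tau> x))"
    using \<tau> by (auto simp: ODP_def op_isometry_on_def subset_iff)
  ultimately show "\<exists>\<theta> :: nat \<Rightarrow> nat. \<theta> ` dom \<alpha> \<subseteq> dom \<beta> \<and> op_isometry_on (dom \<alpha>) \<theta>"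
    by blast
next
  assume "\<exists>\<theta> :: nat \<Rightarrow> nat. \<theta> ` dom \<alpha> \<subseteq> dom \<beta> \<and> op_isometry_on (dom \<alpha>) \<theta>"
  then obtain \<theta> :: "nat \<Rightarrow> nat" where \<theta>: "\<theta> ` dom \<alpha> \<subseteq> dom \<beta>" "op_isometry_on (dom \<alpha>) \<theta>"
    by blast
  \<comment> \<open>The total function \<theta> is cut down to \<open>dom \<alpha>\<close>, the only
    place where its values are controlled.\<close>
  define \<tau> where "\<tau> = (Some \<circ> \<theta>) |` dom \<alpha>"
  have "dom \<tau> = dom \<alpha>" "ran \<tau> = \<theta> ` dom \<alpha>"
    by (auto simp: \<tau>_def ran_def restrict_map_def split: if_splits)
  moreover have "int u - int v = int x - int y" if "\<tau> x = Some u" "\<tau> y = Some v" for x y u v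
    using \<theta>(2) that by (auto simp: \<tau>_def restrict_map_def op_isometry_on_iff split: if_splits)
  \<comment> \<open>The range bound comes through \<open>dom \<beta>\<close>, which lies in
    \<open>{1..n}\<close>.\<close>
  ultimately have \<tau>: "\<tau> \<in> carrier (ODP n)"
    using \<theta>(1) assms unfolding carrier_ODP_iff by (metis subset_trans)
  then have \<tau>\<beta>: "\<beta> \<circ>\<^sub>m \<tau> \<in> carrier (ODP n)"
    using monoid.m_closed[OF monoid_ODP \<tau> assms(2)] by simp
  have "dom \<alpha> \<subseteq> dom (\<beta> \<circ>\<^sub>m \<tau>)"
    using \<theta>(1) by (fastforce simp: \<tau>_def restrict_map_def map_comp_def)
  then have "le_R (ODP n) \<alpha> (\<beta> \<circ>\<^sub>m \<tau>)"
    using assms(1) \<tau>\<beta> le_R_ODP_iff by blast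
  with \<tau> \<tau>\<beta> show "le_D (ODP n) \<alpha> \<beta>"
    by (auto simp: le_D_def le_L_def)
qed

end
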